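(* Let $(l_\triangleright,r_\triangleright,l_\triangleleft,r_\triangleleft,V)$ be a bimodule of an L-dendriform algebra $(A,\triangleright,\triangleleft)$. If $T:V\to A$ is an $\mathcal O$-operator of $(A,\triangleright,\triangleleft)$ associated to $(l_\triangleright,r_\triangleright,l_\triangleleft,r_\triangleleft,V)$, then there exists an L-quadri-algebra structure on $V$ defined, for $u,v\in V$, by $$u\searrow v=l_\triangleright(T(u))v,\quad u\nwarrow v=-r_\triangleright(T(u))v,\quad u\nearrow v=l_\triangleleft(T(u))v,\quad u\swarrow v=-r_\triangleleft(T(u))v.$$ Therefore there is an L-dendriform algebra structure on $V$, namely the associated horizontal L-dendriform algebra of $(V,\searrow,\nearrow,\nwarrow,\swarrow)$, with products $u\searrow v-v\nwarrow u$ and $u\nearrow v-v\swarrow u$, and $T$ is a homomorphism of L-dendriform algebras. Furthermore, $T(V)=\{T(v)\mid v\in V\}\subset A$ is an L-dendriform subalgebra of $(A,\triangleright,\triangleleft)$, and there is an induced L-quadri-algebra structure on $T(V)$ given by $$T(u)\searrow T(v)=T(u\searrow v),\quad T(u)\nearrow T(v)=T(u\nearrow v),\quad T(u)\nwarrow T(v)=T(u\nwarrow v),\quad T(u)\swarrow T(v)=T(u\swarrow v)$$ for all $u,v\in V$. Moreover, the corresponding associated horizontal L-dendriform algebra structure on $T(V)$ is just the L-dendriform algebra structure of $(A,\triangleright,\triangleleft)$ (restricted to $T(V)$), and $T$ is a homomorphism of L-quadri-algebras.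
   Context: All algebras are finite-dimensional over a field of characteristic zero. An L-dendriform algebra $(A,\triangleright,\triangleleft)$ is a vector space $A$ with two bilinear products such that for all $x,y,z\in A$: $x\triangleright(y\triangleright z)-(x\bullet y)\triangleright z=y\triangleright(x\triangleright z)-(y\bullet x)\triangleright z$ and $x\triangleright(y\triangleleft z)-(x\triangleright y)\triangleleft z=y\triangleleft(x\bullet z)-(y\triangleleft x)\triangleleft z$, where $x\bullet y=x\triangleright y+x\triangleleft y$. Put also $x\circ y=x\triangleright y-y\triangleleft x$ and $[x,y]=x\bullet y-y\bullet x$. A bimodule of $(A,\triangleright,\triangleleft)$ is a tuple $(l_\triangleright,r_\triangleright,l_\triangleleft,r_\triangleleft,V)$, with $V$ a vector space and four linear maps $A\to gl(V)$, such that for all $x,y\in A$: $[l_\triangleright(x),l_\triangleright(y)]=l_\triangleright([x,y])$; $[l_\triangleright(x),l_\triangleleft(y)]=l_\triangleleft(x\circ y)+l_\triangleleft(y)l_\triangleleft(x)$; $r_\triangleright(x\triangleright y)=r_\triangleright(y)r_\triangleright(x)+r_\triangleright(y)r_\triangleleft(x)+[l_\triangleright(x),r_\triangleright(y)]-r_\triangleright(y)l_\triangleleft(x)$; $r_\triangleright(x\triangleleft y)=r_\triangleleft(y)r_\triangleright(x)+l_\triangleleft(x)r_\triangleright(y)+[l_\triangleleft(x),r_\triangleleft(y)]$; $[l_\triangleright(x),r_\triangleleft(y)]=r_\triangleleft(x\bullet y)-r_\triangleleft(y)r_\triangleleft(x)$. An $\mathcal O$-operator associated to this bimodule is a linear map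 $T:V\to A$ with $T(u)\triangleright T(v)=T[l_\triangleright(T(u))v+r_\triangleright(T(v))u]$ and $T(u)\triangleleft T(v)=T[l_\triangleleft(T(u))v+r_\triangleleft(T(v))u]$ for all $u,v\in V$. An L-quadri-algebra $(A,\searrow,\nearrow,\nwarrow,\swarrow)$ is a vector space with four bilinear products such that for all $x,y,z\in A$: $x\searrow(y\searrow z)-(x\ast y)\searrow z=y\searrow(x\searrow z)-(y\ast x)\searrow z$; $x\searrow(y\nearrow z)-(x\vee y)\nearrow z=y\nearrow(x\succ z)-(y\wedge x)\nearrow z$; $x\searrow(y\nwarrow z)-(x\searrow y)\nwarrow z=y\nwarrow(x\ast z)-(y\nwarrow x)\nwarrow z$; $x\nearrow(y\prec z)-(x\nearrow y)\nwarrow z=y\swarrow(x\wedge z)-(y\swarrow x)\nwarrow z$; $x\searrow(y\swarrow z)-(x\succ y)\swarrow z=y\swarrow(x\vee z)-(y\prec x)\swarrow z$; where $x\succ y=x\searrow y+x\nearrow y$, $x\prec y=x\nwarrow y+x\swarrow y$, $x\vee y=x\searrow y+x\swarrow y$, $x\wedge y=x\nearrow y+x\nwarrow y$, $x\ast y=x\searrow y+x\nearrow y+x\nwarrow y+x\swarrow y$. Its associated horizontal L-dendriform algebra has products $x\triangleright y=x\searrow y-y\nwarrow x$, $x\triangleleft y=x\nearrow y-y\swarrow x$. *)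

theory Defs
  imports Complex_Main
begin

text \<open>
  An algebra is given by a carrier that is a linear subspace of a vector space
  (the whole type when the carrier is \<^term>\<open>UNIV\<close>) together with operations that matter only
  on this carrier.  In this way the image of a linear map can itself carry algebra structures.
\<close>

definition bilinear_on ::
  "('k::field \<Rightarrow> 'a::ab_group_add \<Rightarrow> 'a) \<Rightarrow> 'a set \<Rightarrow> ('a \<Rightarrow> 'a \<Rightarrow> 'a) \<Rightarrow> bool"
  where "bilinear_on scale A p \<longleftrightarrow>
    (\<forall>x\<in>A. \<forall>y\<in>A. p x y \<in> A) \<and>
    (\<forall>x\<in>A. \<forall>y\<in>A. \<forall>z\<in>A. p (x + y) z = p x z + p y z \<and> p x (y + z) = p x y + p x z) \<and>
    (\<forall>c. \<forall>x\<in>A. \<forall>y\<in>A. p (scale c x) y = scale c (p x y) \<and> p x (scale c y) = scale c (p x y))"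

definition linear_on ::
  "('k::field \<Rightarrow> 'a::ab_group_add \<Rightarrow> 'a) \<Rightarrow> ('k \<Rightarrow> 'b::ab_group_add \<Rightarrow> 'b) \<Rightarrow>
   'a set \<Rightarrow> 'b set \<Rightarrow> ('a \<Rightarrow> 'b) \<Rightarrow> bool"
  where "linear_on scaleA scaleB A B f \<longleftrightarrow>
    (\<forall>x\<in>A. f x \<in> B) \<and>
    (\<forall>x\<in>A. \<forall>y\<in>A. f (x + y) = f x + f y) \<and>
    (\<forall>c. \<forall>x\<in>A. f (scaleA c x) = scaleB c (f x))"


subsection \<open>L-dendriform algebras\<close>

locale L_dendriform_operations =
  fixes rtri :: "'a::ab_group_add \<Rightarrow> 'a \<Rightarrow> 'a"  (infixl "\<triangleright>" 70)
    and ltri :: "'a \<Rightarrow> 'a \<Rightarrow> 'a"  (infixl "\<triangleleft>" 70)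
begin

definition bul :: "'a \<Rightarrow> 'a \<Rightarrow> 'a"  (infixl "\<bullet>" 70)
  where "x \<bullet> y = x \<triangleright> y + x \<triangleleft> y"

text \<open>\<open>\<odot>\<close> is the product usually written with the symbol for composition, which is taken.\<close>

definition circ :: "'a \<Rightarrow> 'a \<Rightarrow> 'a"  (infixl "\<odot>" 70)
  where "x \<odot> y = x \<triangleright> y - y \<triangleleft> x"

definition brack :: "'a \<Rightarrow> 'a \<Rightarrow> 'a"
  where "brack x y = x \<bullet> y - y \<bullet> x"

end

locale L_dendriform_algebra =
  vector_space scale + L_dendriform_operations rtri ltri
  for scale :: "'k::field_char_0 \<Rightarrow> 'a::ab_group_add \<Rightarrow> 'a"
    and A :: "'a set"
    and rtri :: "'a \<Rightarrow> 'a \<Rightarrow> 'a"  (infixl "\<triangleright>" 70)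
    and ltri :: "'a \<Rightarrow> 'a \<Rightarrow> 'a"  (infixl "\<triangleleft>" 70) +
  assumes subspace_carrier: "subspace A"
    and bilinear_rtri: "bilinear_on scale A (\<triangleright>)"
    and bilinear_ltri: "bilinear_on scale A (\<triangleleft>)"
    and L_dendriform_1: "\<lbrakk>x \<in> A; y \<in> A; z \<in> A\<rbrakk> \<Longrightarrow>
      x \<triangleright> (y \<triangleright> z) - (x \<bullet> y) \<triangleright> z = y \<triangleright> (x \<triangleright> z) - (y \<bullet> x) \<triangleright> z"
    and L_dendriform_2: "\<lbrakk>x \<in> A; y \<in> A; z \<in> A\<rbrakk> \<Longrightarrow>
      x \<triangleright> (y \<triangleleft> z) - (x \<triangleright> y) \<triangleleft> z = y \<triangleleft> (x \<bullet> z) - (y \<triangleleft> x) \<triangleleft> z"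

definition L_dendriform_subalgebra ::
  "('k::field_char_0 \<Rightarrow> 'a::ab_group_add \<Rightarrow> 'a) \<Rightarrow> 'a set \<Rightarrow>
   ('a \<Rightarrow> 'a \<Rightarrow> 'a) \<Rightarrow> ('a \<Rightarrow> 'a \<Rightarrow> 'a) \<Rightarrow> 'a set \<Rightarrow> bool"
  where "L_dendriform_subalgebra scale A rtri ltri B \<longleftrightarrow>
    L_dendriform_algebra scale A rtri ltri \<and> B \<subseteq> A \<and> module.subspace scale B \<and>
    (\<forall>x\<in>B. \<forall>y\<in>B. rtri x y \<in> B \<and> ltri x y \<in> B)"

definition L_dendriform_hom ::
  "('k::field_char_0 \<Rightarrow> 'a::ab_group_add \<Rightarrow> 'a) \<Rightarrow> 'a set \<Rightarrow>
   ('a \<Rightarrow> 'a \<Rightarrow> 'a) \<Rightarrow> ('a \<Rightarrow> 'a \<Rightarrow> 'a) \<Rightarrow>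
   ('k \<Rightarrow> 'b::ab_group_add \<Rightarrow> 'b) \<Rightarrow> 'b set \<Rightarrow>
   ('b \<Rightarrow> 'b \<Rightarrow> 'b) \<Rightarrow> ('b \<Rightarrow> 'b \<Rightarrow> 'b) \<Rightarrow> ('a \<Rightarrow> 'b) \<Rightarrow> bool"
  where "L_dendriform_hom scaleA A rtri ltri scaleB B rtri' ltri' f \<longleftrightarrow>
    L_dendriform_algebra scaleA A rtri ltri \<and> L_dendriform_algebra scaleB B rtri' ltri' \<and>
    linear_on scaleA scaleB A B f \<and>
    (\<forall>x\<in>A. \<forall>y\<in>A. f (rtri x y) = rtri' (f x) (f y) \<and> f (ltri x y) = ltri' (f x) (f y))"


subsection \<open>Bimodules and O-operators\<close>

text \<open>The commutator in \<open>gl(V)\<close>; products of operators are compositions.\<close>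

definition gl_bracket :: "('v::ab_group_add \<Rightarrow> 'v) \<Rightarrow> ('v \<Rightarrow> 'v) \<Rightarrow> 'v \<Rightarrow> 'v"
  where "gl_bracket f g v = f (g v) - g (f v)"

definition linear_to_gl ::
  "('k::field \<Rightarrow> 'a::ab_group_add \<Rightarrow> 'a) \<Rightarrow> ('k \<Rightarrow> 'v::ab_group_add \<Rightarrow> 'v) \<Rightarrow>
   ('a \<Rightarrow> 'v \<Rightarrow> 'v) \<Rightarrow> bool"
  where "linear_to_gl scaleA scaleV l \<longleftrightarrow>
    (\<forall>x. Vector_Spaces.linear scaleV scaleV (l x)) \<and>
    (\<forall>v. Vector_Spaces.linear scaleA scaleV (\<lambda>x. l x v))"

locale L_dendriform_bimodule =
  L_dendriform_algebra scaleA UNIV rtri ltri + V: vector_space scaleV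
  for scaleA :: "'k::field_char_0 \<Rightarrow> 'a::ab_group_add \<Rightarrow> 'a"
    and rtri :: "'a \<Rightarrow> 'a \<Rightarrow> 'a"  (infixl "\<triangleright>" 70)
    and ltri :: "'a \<Rightarrow> 'a \<Rightarrow> 'a"  (infixl "\<triangleleft>" 70)
    and scaleV :: "'k \<Rightarrow> 'v::ab_group_add \<Rightarrow> 'v" +
  fixes l_rtri r_rtri l_ltri r_ltri :: "'a \<Rightarrow> 'v \<Rightarrow> 'v"
  assumes linear_l_rtri: "linear_to_gl scaleA scaleV l_rtri"
    and linear_r_rtri: "linear_to_gl scaleA scaleV r_rtri"
    and linear_l_ltri: "linear_to_gl scaleA scaleV l_ltri"
    and linear_r_ltri: "linear_to_gl scaleA scaleV r_ltri"
    and bimodule_1: "gl_bracket (l_rtri x) (l_rtri y) v = l_rtri (brack x y) v"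
    and bimodule_2: "gl_bracket (l_rtri x) (l_ltri y) v
      = l_ltri (x \<odot> y) v + l_ltri y (l_ltri x v)"
    and bimodule_3: "r_rtri (x \<triangleright> y) v
      = r_rtri y (r_rtri x v) + r_rtri y (r_ltri x v)
        + gl_bracket (l_rtri x) (r_rtri y) v - r_rtri y (l_ltri x v)"
    and bimodule_4: "r_rtri (x \<triangleleft> y) v
      = r_ltri y (r_rtri x v) + l_ltri x (r_rtri y v) + gl_bracket (l_ltri x) (r_ltri y) v"
    and bimodule_5: "gl_bracket (l_rtri x) (r_ltri y) v
      = r_ltri (x \<bullet> y) v - r_ltri y (r_ltri x v)"

locale O_operator =
  L_dendriform_bimodule scaleA rtri ltri scaleV l_rtri r_rtri l_ltri r_ltri
  for scaleA :: "'k::field_char_0 \<Rightarrow> 'a::ab_group_add \<Rightarrow> 'a"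
    and rtri :: "'a \<Rightarrow> 'a \<Rightarrow> 'a"  (infixl "\<triangleright>" 70)
    and ltri :: "'a \<Rightarrow> 'a \<Rightarrow> 'a"  (infixl "\<triangleleft>" 70)
    and scaleV :: "'k \<Rightarrow> 'v::ab_group_add \<Rightarrow> 'v"
    and l_rtri r_rtri l_ltri r_ltri :: "'a \<Rightarrow> 'v \<Rightarrow> 'v" +
  fixes T :: "'v \<Rightarrow> 'a"
  assumes linear_T: "Vector_Spaces.linear scaleV scaleA T"
    and O_operator_rtri: "T u \<triangleright> T v = T (l_rtri (T u) v + r_rtri (T v) u)"
    and O_operator_ltri: "T u \<triangleleft> T v = T (l_ltri (T u) v + r_ltri (T v) u)"


subsection \<open>L-quadri-algebras\<close>

locale L_quadri_operations =
  fixes se :: "'a::ab_group_add \<Rightarrow> 'a \<Rightarrow> 'a"  (infixl "\<searrow>" 70)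
    and ne :: "'a \<Rightarrow> 'a \<Rightarrow> 'a"  (infixl "\<nearrow>" 70)
    and nw :: "'a \<Rightarrow> 'a \<Rightarrow> 'a"  (infixl "\<nwarrow>" 70)
    and sw :: "'a \<Rightarrow> 'a \<Rightarrow> 'a"  (infixl "\<swarrow>" 70)
begin

definition q_succ :: "'a \<Rightarrow> 'a \<Rightarrow> 'a"  (infixl "\<succ>" 70)
  where "x \<succ> y = x \<searrow> y + x \<nearrow> y"

definition q_prec :: "'a \<Rightarrow> 'a \<Rightarrow> 'a"  (infixl "\<prec>" 70)
  where "x \<prec> y = x \<nwarrow> y + x \<swarrow> y"

definition q_vee :: "'a \<Rightarrow> 'a \<Rightarrow> 'a"  (infixl "\<or>\<^sub>q" 70)
  where "x \<or>\<^sub>q y = x \<searrow> y + x \<swarrow> y"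

definition q_wedge :: "'a \<Rightarrow> 'a \<Rightarrow> 'a"  (infixl "\<and>\<^sub>q" 70)
  where "x \<and>\<^sub>q y = x \<nearrow> y + x \<nwarrow> y"

definition q_ast :: "'a \<Rightarrow> 'a \<Rightarrow> 'a"  (infixl "\<star>" 70)
  where "x \<star> y = x \<searrow> y + x \<nearrow> y + x \<nwarrow> y + x \<swarrow> y"

end

locale L_quadri_algebra =
  vector_space scale + L_quadri_operations se ne nw sw
  for scale :: "'k::field_char_0 \<Rightarrow> 'a::ab_group_add \<Rightarrow> 'a"
    and A :: "'a set"
    and se :: "'a \<Rightarrow> 'a \<Rightarrow> 'a"  (infixl "\<searrow>" 70)
    and ne :: "'a \<Rightarrow> 'a \<Rightarrow> 'a"  (infixl "\<nearrow>" 70)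
    and nw :: "'a \<Rightarrow> 'a \<Rightarrow> 'a"  (infixl "\<nwarrow>" 70)
    and sw :: "'a \<Rightarrow> 'a \<Rightarrow> 'a"  (infixl "\<swarrow>" 70) +
  assumes subspace_carrier: "subspace A"
    and bilinear_se: "bilinear_on scale A (\<searrow>)"
    and bilinear_ne: "bilinear_on scale A (\<nearrow>)"
    and bilinear_nw: "bilinear_on scale A (\<nwarrow>)"
    and bilinear_sw: "bilinear_on scale A (\<swarrow>)"
    and L_quadri_1: "\<lbrakk>x \<in> A; y \<in> A; z \<in> A\<rbrakk> \<Longrightarrow>
      x \<searrow> (y \<searrow> z) - (x \<star> y) \<searrow> z = y \<searrow> (x \<searrow> z) - (y \<star> x) \<searrow> z"
    and L_quadri_2: "\<lbrakk>x \<in> A; y \<in> A; z \<in> A\<rbrakk> \<Longrightarrow>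
      x \<searrow> (y \<nearrow> z) - (x \<or>\<^sub>q y) \<nearrow> z = y \<nearrow> (x \<succ> z) - (y \<and>\<^sub>q x) \<nearrow> z"
    and L_quadri_3: "\<lbrakk>x \<in> A; y \<in> A; z \<in> A\<rbrakk> \<Longrightarrow>
      x \<searrow> (y \<nwarrow> z) - (x \<searrow> y) \<nwarrow> z = y \<nwarrow> (x \<star> z) - (y \<nwarrow> x) \<nwarrow> z"
    and L_quadri_4: "\<lbrakk>x \<in> A; y \<in> A; z \<in> A\<rbrakk> \<Longrightarrow>
      x \<nearrow> (y \<prec> z) - (x \<nearrow> y) \<nwarrow> z = y \<swarrow> (x \<and>\<^sub>q z) - (y \<swarrow> x) \<nwarrow> z"
    and L_quadri_5: "\<lbrakk>x \<in> A; y \<in> A; z \<in> A\<rbrakk> \<Longrightarrow>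
      x \<searrow> (y \<swarrow> z) - (x \<succ> y) \<swarrow> z = y \<swarrow> (x \<or>\<^sub>q z) - (y \<prec> x) \<swarrow> z"

definition L_quadri_hom ::
  "('k::field_char_0 \<Rightarrow> 'a::ab_group_add \<Rightarrow> 'a) \<Rightarrow> 'a set \<Rightarrow>
   ('a \<Rightarrow> 'a \<Rightarrow> 'a) \<Rightarrow> ('a \<Rightarrow> 'a \<Rightarrow> 'a) \<Rightarrow> ('a \<Rightarrow> 'a \<Rightarrow> 'a) \<Rightarrow> ('a \<Rightarrow> 'a \<Rightarrow> 'a) \<Rightarrow>
   ('k \<Rightarrow> 'b::ab_group_add \<Rightarrow> 'b) \<Rightarrow> 'b set \<Rightarrow>
   ('b \<Rightarrow> 'b \<Rightarrow> 'b) \<Rightarrow> ('b \<Rightarrow> 'b \<Rightarrow> 'b) \<Rightarrow> ('b \<Rightarrow> 'b \<Rightarrow> 'b) \<Rightarrow> ('b \<Rightarrow> 'b \<Rightarrow> 'b) \<Rightarrow>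
   ('a \<Rightarrow> 'b) \<Rightarrow> bool"
  where "L_quadri_hom scaleA A se ne nw sw scaleB B se' ne' nw' sw' f \<longleftrightarrow>
    L_quadri_algebra scaleA A se ne nw sw \<and> L_quadri_algebra scaleB B se' ne' nw' sw' \<and>
    linear_on scaleA scaleB A B f \<and>
    (\<forall>x\<in>A. \<forall>y\<in>A. f (se x y) = se' (f x) (f y) \<and> f (ne x y) = ne' (f x) (f y) \<and>
      f (nw x y) = nw' (f x) (f y) \<and> f (sw x y) = sw' (f x) (f y))"

text \<open>The products of the associated horizontal L-dendriform algebra.\<close>

definition horizontal_rtri ::
  "('a::ab_group_add \<Rightarrow> 'a \<Rightarrow> 'a) \<Rightarrow> ('a \<Rightarrow> 'a \<Rightarrow> 'a) \<Rightarrow> 'a \<Rightarrow> 'a \<Rightarrow> 'a"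
  where "horizontal_rtri se nw x y = se x y - nw y x"

definition horizontal_ltri ::
  "('a::ab_group_add \<Rightarrow> 'a \<Rightarrow> 'a) \<Rightarrow> ('a \<Rightarrow> 'a \<Rightarrow> 'a) \<Rightarrow> 'a \<Rightarrow> 'a \<Rightarrow> 'a"
  where "horizontal_ltri ne sw x y = ne x y - sw y x"

end

theory Submission
  imports Defs
begin

text \<open>
  With \<open>x = T u\<close> and \<open>y = T v\<close>, the \<open>\<O>\<close>-operator identities say that
  \<open>T (u \<searrow> v - v \<nwarrow> u) = x \<triangleright> y\<close> and \<open>T (u \<nearrow> v - v \<swarrow> u) = x \<triangleleft> y\<close>; in each L-quadri-algebra
  axiom the terms whose left factor is a product combine to \<open>T\<close> of such a difference, and the
  axiom becomes the bimodule axiom of the same number.  The products descend to \<open>T(V)\<close> because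
  they depend on the left argument only through \<open>T u\<close>, while \<open>T v = 0\<close> gives
  \<open>T (l\<^sub>\<triangleright> (T u) v) = T u \<triangleright> 0 = 0\<close>, and likewise for the other three actions.
\<close>

lemma linear_to_glD:
  assumes "linear_to_gl sA sV l"
  shows "l x (v + w) = l x v + l x w" "l x (v - w) = l x v - l x w" "l x (- v) = - l x v"
    "l x (sV c v) = sV c (l x v)"
    "l (x + y) v = l x v + l y v" "l (x - y) v = l x v - l y v" "l (- x) v = - l x v"
    "l (sA c x) v = sV c (l x v)"
proof -
  interpret right: Vector_Spaces.linear sV sV "l x" for x
    using assms by (simp add: linear_to_gl_def)
  interpret left: Vector_Spaces.linear sA sV "\<lambda>x. l x v" for v
    using assms by (simp add: linear_to_gl_def)
  show "l x (v + w) = l x v + l x w" "l x (v - w) = l x v - l x w" "l x (- v) = - l x v"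
    "l x (sV c v) = sV c (l x v)"
    by (simp_all add: right.add right.diff right.neg right.scale)
  show "l (x + y) v = l x v + l y v" "l (x - y) v = l x v - l y v" "l (- x) v = - l x v"
    "l (sA c x) v = sV c (l x v)"
    by (simp_all add: left.add left.diff left.neg left.scale)
qed

context vector_space
begin

lemma bilinear_onD:
  assumes "bilinear_on scale A p" "x \<in> A" "y \<in> A"
  shows "p x y \<in> A" "p (scale c x) y = scale c (p x y)" "p x (scale c y) = scale c (p x y)"
  using assms unfolding bilinear_on_def by blast+

text \<open>\<open>bilinear_on\<close> records additivity but says nothing about subtraction. The
  difference rules come from additivity at \<open>(x - y) + y\<close>, which is legitimate because a
  subspace contains \<open>x - y\<close>.\<close>

lemma bilinear_on_add_diff:
  assumes "bilinear_on scale A p" "subspace A" "x \<in> A" "y \<in> A" "z \<in> A"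
  shows "p (x + y) z = p x z + p y z" "p z (x + y) = p z x + p z y"
    "p (x - y) z = p x z - p y z" "p z (x - y) = p z x - p z y"
proof -
  show "p (x + y) z = p x z + p y z" "p z (x + y) = p z x + p z y"
    using assms unfolding bilinear_on_def by blast+
  have "x - y \<in> A"
    using assms by (simp add: subspace_diff)
  then have "p ((x - y) + y) z = p (x - y) z + p y z" "p z ((x - y) + y) = p z (x - y) + p z y"
    using assms unfolding bilinear_on_def by blast+
  then show "p (x - y) z = p x z - p y z" "p z (x - y) = p z x - p z y"
    by simp_all
qed

lemma bilinear_on_diff_flip:
  assumes "bilinear_on scale A p" "bilinear_on scale A q" "subspace A"
  shows "bilinear_on scale A (\<lambda>x y. p x y - q y x)"
  using assms unfolding bilinear_on_def
  by (auto simp: subspace_diff scale_right_diff_distrib)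

end

text \<open>In each L-quadri axiom the third argument is the rightmost factor of every monomial.
  After expansion of a horizontal axiom, the monomials sharing a rightmost variable form one such
  axiom, up to sign. For the first horizontal axiom, \<open>z\<close> gives axiom 1, while
  \<open>y\<close> and \<open>x\<close> each give axiom 3; for the second, \<open>z\<close>,
  \<open>x\<close>, \<open>y\<close> give axioms 2, 4, 5.\<close>

lemma (in L_quadri_algebra) horizontal_L_dendriform_algebra:
  "L_dendriform_algebra scale A (horizontal_rtri (\<searrow>) (\<nwarrow>)) (horizontal_ltri (\<nearrow>) (\<swarrow>))"
proof
  let ?rtri = "horizontal_rtri (\<searrow>) (\<nwarrow>)" and ?ltri = "horizontal_ltri (\<nearrow>) (\<swarrow>)"
  show "subspace A"
    by (rule subspace_carrier)
  show "bilinear_on scale A ?rtri" "bilinear_on scale A ?ltri"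
    using bilinear_on_diff_flip[OF bilinear_se bilinear_nw subspace_carrier]
      bilinear_on_diff_flip[OF bilinear_ne bilinear_sw subspace_carrier]
    by (simp_all add: horizontal_rtri_def[abs_def] horizontal_ltri_def[abs_def])
  note closed = bilinear_onD(1)[OF bilinear_se] bilinear_onD(1)[OF bilinear_ne]
    bilinear_onD(1)[OF bilinear_nw] bilinear_onD(1)[OF bilinear_sw]
  note bilinear = closed bilinear_on_add_diff[OF bilinear_se subspace_carrier]
    bilinear_on_add_diff[OF bilinear_ne subspace_carrier]
    bilinear_on_add_diff[OF bilinear_nw subspace_carrier]
    bilinear_on_add_diff[OF bilinear_sw subspace_carrier]
    subspace_add[OF subspace_carrier] subspace_diff[OF subspace_carrier]
  note defs = horizontal_rtri_def horizontal_ltri_def L_dendriform_operations.bul_def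
    q_succ_def q_prec_def q_vee_def q_wedge_def q_ast_def
  fix x y z
  assume A: "x \<in> A" "y \<in> A" "z \<in> A"
  show "?rtri x (?rtri y z) - ?rtri (L_dendriform_operations.bul ?rtri ?ltri x y) z
    = ?rtri y (?rtri x z) - ?rtri (L_dendriform_operations.bul ?rtri ?ltri y x) z"
    \<comment> \<open>The two instances of axiom 3 occur with opposite signs, so one is reversed
      before they are added.\<close>
    using L_quadri_1[OF A] arg_cong2[where f = "(+)",
        OF L_quadri_3[OF A(1,3,2)] L_quadri_3[OF A(2,3,1), symmetric]]
    by (simp add: defs bilinear A algebra_simps)
  show "?rtri x (?ltri y z) - ?ltri (?rtri x y) z
    = ?ltri y (L_dendriform_operations.bul ?rtri ?ltri x z) - ?ltri (?ltri y x) z"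
    using arg_cong2[where f = "(+)", OF L_quadri_2[OF A]
        arg_cong2[where f = "(+)",
          OF L_quadri_4[OF A(2,3,1)] L_quadri_5[OF A(1,3,2), symmetric]]]
    by (simp add: defs bilinear A algebra_simps)
qed

text \<open>The primed products are arbitrary functions compatible with \<open>f\<close>, so
  well-definedness on the image is left to whoever supplies them. Compatibility turns each side of
  an axiom at image points into \<open>f\<close> of the same side in \<open>A\<close>.\<close>

lemma (in L_quadri_algebra) L_quadri_algebra_image:
  assumes f: "Vector_Spaces.linear scale scaleB f"
    and se': "\<And>x y. x \<in> A \<Longrightarrow> y \<in> A \<Longrightarrow> se' (f x) (f y) = f (x \<searrow> y)"
    and ne': "\<And>x y. x \<in> A \<Longrightarrow> y \<in> A \<Longrightarrow> ne' (f x) (f y) = f (x \<nearrow> y)"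
    and nw': "\<And>x y. x \<in> A \<Longrightarrow> y \<in> A \<Longrightarrow> nw' (f x) (f y) = f (x \<nwarrow> y)"
    and sw': "\<And>x y. x \<in> A \<Longrightarrow> y \<in> A \<Longrightarrow> sw' (f x) (f y) = f (x \<swarrow> y)"
  shows "L_quadri_algebra scaleB (f ` A) se' ne' nw' sw'"
proof -
  interpret f: Vector_Spaces.linear scale scaleB f
    by (rule f)
  note f_simps = f.add[symmetric] f.diff[symmetric] f.scale[symmetric]
  have bilinear_image: "bilinear_on scaleB (f ` A) p'"
    if p: "bilinear_on scale A p"
      and p': "\<And>x y. x \<in> A \<Longrightarrow> y \<in> A \<Longrightarrow> p' (f x) (f y) = f (p x y)" for p p'
    unfolding bilinear_on_def
    using bilinear_onD[OF p] bilinear_on_add_diff[OF p subspace_carrier] subspace_carrier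
    by (auto simp: p' f_simps subspace_add subspace_scale)
  note closed = bilinear_onD(1)[OF bilinear_se] bilinear_onD(1)[OF bilinear_ne]
    bilinear_onD(1)[OF bilinear_nw] bilinear_onD(1)[OF bilinear_sw]
    subspace_add[OF subspace_carrier]
  note defs = L_quadri_operations.q_succ_def L_quadri_operations.q_prec_def
    L_quadri_operations.q_vee_def L_quadri_operations.q_wedge_def L_quadri_operations.q_ast_def
  \<comment> \<open>Linearity is used from right to left, collecting each side under a single
    \<open>f\<close>. The closure facts discharge the membership conditions of \<open>se'\<close> to
    \<open>sw'\<close> for nested products.\<close>
  note push = defs se' ne' nw' sw' f_simps closed
  show ?thesis
  proof
    show "f.vs2.subspace (f ` A)"
      by (rule f.subspace_image[OF subspace_carrier])
    show "bilinear_on scaleB (f ` A) se'" "bilinear_on scaleB (f ` A) ne'"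
      "bilinear_on scaleB (f ` A) nw'" "bilinear_on scaleB (f ` A) sw'"
      by (rule bilinear_image[OF bilinear_se se'] bilinear_image[OF bilinear_ne ne']
        bilinear_image[OF bilinear_nw nw'] bilinear_image[OF bilinear_sw sw']; assumption)+
    fix x' y' z'
    assume "x' \<in> f ` A" "y' \<in> f ` A" "z' \<in> f ` A"
    then obtain x y z where A: "x \<in> A" "y \<in> A" "z \<in> A"
      and eq: "x' = f x" "y' = f y" "z' = f z"
      by blast
    show "se' x' (se' y' z') - se' (L_quadri_operations.q_ast se' ne' nw' sw' x' y') z'
      = se' y' (se' x' z') - se' (L_quadri_operations.q_ast se' ne' nw' sw' y' x') z'"
      using L_quadri_1[OF A] by (simp add: eq push A)
    show "se' x' (ne' y' z') - ne' (L_quadri_operations.q_vee se' sw' x' y') z'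
      = ne' y' (L_quadri_operations.q_succ se' ne' x' z')
        - ne' (L_quadri_operations.q_wedge ne' nw' y' x') z'"
      using L_quadri_2[OF A] by (simp add: eq push A)
    show "se' x' (nw' y' z') - nw' (se' x' y') z'
      = nw' y' (L_quadri_operations.q_ast se' ne' nw' sw' x' z') - nw' (nw' y' x') z'"
      using L_quadri_3[OF A] by (simp add: eq push A)
    show "ne' x' (L_quadri_operations.q_prec nw' sw' y' z') - nw' (ne' x' y') z'
      = sw' y' (L_quadri_operations.q_wedge ne' nw' x' z') - nw' (sw' y' x') z'"
      using L_quadri_4[OF A] by (simp add: eq push A)
    show "se' x' (sw' y' z') - sw' (L_quadri_operations.q_succ se' ne' x' y') z'
      = sw' y' (L_quadri_operations.q_vee se' sw' x' z')
        - sw' (L_quadri_operations.q_prec nw' sw' y' x') z'"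
      using L_quadri_5[OF A] by (simp add: eq push A)
  qed
qed

context O_operator
begin

sublocale T: Vector_Spaces.linear scaleV scaleA T
  by (rule linear_T)

lemmas action_simps = linear_to_glD[OF linear_l_rtri] linear_to_glD[OF linear_r_rtri]
  linear_to_glD[OF linear_l_ltri] linear_to_glD[OF linear_r_ltri]

lemma rtri_T: "T u \<triangleright> T v = T (l_rtri (T u) v) + T (r_rtri (T v) u)"
  by (simp add: O_operator_rtri T.add)

lemma ltri_T: "T u \<triangleleft> T v = T (l_ltri (T u) v) + T (r_ltri (T v) u)"
  by (simp add: O_operator_ltri T.add)

lemma L_quadri_algebra_of_O_operator:
  "L_quadri_algebra scaleV UNIV (\<lambda>u v. l_rtri (T u) v) (\<lambda>u v. l_ltri (T u) v)
    (\<lambda>u v. - r_rtri (T u) v) (\<lambda>u v. - r_ltri (T u) v)"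
proof
  note defs = L_quadri_operations.q_succ_def L_quadri_operations.q_prec_def
    L_quadri_operations.q_vee_def L_quadri_operations.q_wedge_def L_quadri_operations.q_ast_def
  \<comment> \<open>Rewriting \<open>T u \<triangleright> T v\<close> and
    \<open>T u \<triangleleft> T v\<close> as sums of images under \<open>T\<close> brings the
    bimodule axioms and the goals to the same normal form: signed sums of iterated actions on
    \<open>w\<close>.\<close>
  note expand = defs action_simps T.add T.diff T.neg T.scale gl_bracket_def
    brack_def bul_def circ_def rtri_T ltri_T
  show "V.subspace UNIV"
    by simp
  show "bilinear_on scaleV UNIV (\<lambda>u v. l_rtri (T u) v)"
    "bilinear_on scaleV UNIV (\<lambda>u v. l_ltri (T u) v)"
    "bilinear_on scaleV UNIV (\<lambda>u v. - r_rtri (T u) v)"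
    "bilinear_on scaleV UNIV (\<lambda>u v. - r_ltri (T u) v)"
    unfolding bilinear_on_def by (simp_all add: action_simps T.add T.scale)
  fix u v w
  show "l_rtri (T u) (l_rtri (T v) w)
      - l_rtri (T (L_quadri_operations.q_ast (\<lambda>u v. l_rtri (T u) v) (\<lambda>u v. l_ltri (T u) v)
          (\<lambda>u v. - r_rtri (T u) v) (\<lambda>u v. - r_ltri (T u) v) u v)) w
    = l_rtri (T v) (l_rtri (T u) w)
      - l_rtri (T (L_quadri_operations.q_ast (\<lambda>u v. l_rtri (T u) v) (\<lambda>u v. l_ltri (T u) v)
          (\<lambda>u v. - r_rtri (T u) v) (\<lambda>u v. - r_ltri (T u) v) v u)) w"
    using bimodule_1[of "T u" "T v" w] by (simp add: expand algebra_simps)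
  show "l_rtri (T u) (l_ltri (T v) w)
      - l_ltri (T (L_quadri_operations.q_vee (\<lambda>u v. l_rtri (T u) v) (\<lambda>u v. - r_ltri (T u) v) u v)) w
    = l_ltri (T v) (L_quadri_operations.q_succ (\<lambda>u v. l_rtri (T u) v) (\<lambda>u v. l_ltri (T u) v) u w)
      - l_ltri (T (L_quadri_operations.q_wedge (\<lambda>u v. l_ltri (T u) v) (\<lambda>u v. - r_rtri (T u) v) v u)) w"
    using bimodule_2[of "T u" "T v" w] by (simp add: expand algebra_simps)
  show "l_rtri (T u) (- r_rtri (T v) w) - - r_rtri (T (l_rtri (T u) v)) w
    = - r_rtri (T v) (L_quadri_operations.q_ast (\<lambda>u v. l_rtri (T u) v) (\<lambda>u v. l_ltri (T u) v)
          (\<lambda>u v. - r_rtri (T u) v) (\<lambda>u v. - r_ltri (T u) v) u w)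
      - - r_rtri (T (- r_rtri (T v) u)) w"
    using bimodule_3[of "T u" "T v" w] by (simp add: expand algebra_simps)
  show "l_ltri (T u) (L_quadri_operations.q_prec (\<lambda>u v. - r_rtri (T u) v) (\<lambda>u v. - r_ltri (T u) v) v w)
      - - r_rtri (T (l_ltri (T u) v)) w
    = - r_ltri (T v) (L_quadri_operations.q_wedge (\<lambda>u v. l_ltri (T u) v) (\<lambda>u v. - r_rtri (T u) v) u w)
      - - r_rtri (T (- r_ltri (T v) u)) w"
    using bimodule_4[of "T u" "T v" w] by (simp add: expand algebra_simps)
  show "l_rtri (T u) (- r_ltri (T v) w)
      - - r_ltri (T (L_quadri_operations.q_succ (\<lambda>u v. l_rtri (T u) v) (\<lambda>u v. l_ltri (T u) v) u v)) w
    = - r_ltri (T v) (L_quadri_operations.q_vee (\<lambda>u v. l_rtri (T u) v) (\<lambda>u v. - r_ltri (T u) v) u w)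
      - - r_ltri (T (L_quadri_operations.q_prec (\<lambda>u v. - r_rtri (T u) v) (\<lambda>u v. - r_ltri (T u) v) v u)) w"
    using bimodule_5[of "T u" "T v" w] by (simp add: expand algebra_simps)
qed

text \<open>This makes the products on the image independent of the representative of the right
  factor. In \<open>T u \<triangleright> T v = T (l_rtri (T u) v) + T (r_rtri (T v) u)\<close>, the
  left side and the last summand depend on \<open>v\<close> only through \<open>T v\<close>, hence
  so does the remaining summand; the other cases are alike.\<close>

lemma T_action_cong:
  assumes "T v = T w"
  shows "T (l_rtri (T u) v) = T (l_rtri (T u) w)" "T (r_rtri (T u) v) = T (r_rtri (T u) w)"
    "T (l_ltri (T u) v) = T (l_ltri (T u) w)" "T (r_ltri (T u) v) = T (r_ltri (T u) w)"
  using rtri_T[of u v] rtri_T[of u w] rtri_T[of v u] rtri_T[of w u]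
    ltri_T[of u v] ltri_T[of u w] ltri_T[of v u] ltri_T[of w u] assms
  by simp_all

end

theorem proposition3p11:
  fixes scaleA :: "'k::field_char_0 \<Rightarrow> 'a::ab_group_add \<Rightarrow> 'a"
    and scaleV :: "'k \<Rightarrow> 'v::ab_group_add \<Rightarrow> 'v"
    and rtri ltri :: "'a \<Rightarrow> 'a \<Rightarrow> 'a"
    and l_rtri r_rtri l_ltri r_ltri :: "'a \<Rightarrow> 'v \<Rightarrow> 'v"
    and T :: "'v \<Rightarrow> 'a"
  assumes A: "L_dendriform_algebra scaleA UNIV rtri ltri"
    and fin_dim_A: "\<exists>Basis. finite_dimensional_vector_space scaleA Basis"
    and V: "L_dendriform_bimodule scaleA rtri ltri scaleV l_rtri r_rtri l_ltri r_ltri"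
    and T: "O_operator scaleA rtri ltri scaleV l_rtri r_rtri l_ltri r_ltri T"
  shows
    "let se = (\<lambda>u v. l_rtri (T u) v);
         nw = (\<lambda>u v. - r_rtri (T u) v);
         ne = (\<lambda>u v. l_ltri (T u) v);
         sw = (\<lambda>u v. - r_ltri (T u) v)
     in
       L_quadri_algebra scaleV UNIV se ne nw sw \<and>
       L_dendriform_algebra scaleV UNIV (horizontal_rtri se nw) (horizontal_ltri ne sw) \<and>
       L_dendriform_hom scaleV UNIV (horizontal_rtri se nw) (horizontal_ltri ne sw)
         scaleA UNIV rtri ltri T \<and>
       L_dendriform_subalgebra scaleA UNIV rtri ltri (range T) \<and>
       (\<exists>se' ne' nw' sw'.
          (\<forall>u v. se' (T u) (T v) = T (se u v) \<and> ne' (T u) (T v) = T (ne u v) \<and>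
                 nw' (T u) (T v) = T (nw u v) \<and> sw' (T u) (T v) = T (sw u v)) \<and>
          L_quadri_algebra scaleA (range T) se' ne' nw' sw' \<and>
          L_dendriform_algebra scaleA (range T)
            (horizontal_rtri se' nw') (horizontal_ltri ne' sw') \<and>
          (\<forall>x\<in>range T. \<forall>y\<in>range T.
             horizontal_rtri se' nw' x y = rtri x y \<and> horizontal_ltri ne' sw' x y = ltri x y) \<and>
          L_quadri_hom scaleV UNIV se ne nw sw scaleA (range T) se' ne' nw' sw' T)"
proof -
  interpret O_operator scaleA rtri ltri scaleV l_rtri r_rtri l_ltri r_ltri T
    by (rule T)
  define se where "se = (\<lambda>u v. l_rtri (T u) v)"
  define nw where "nw = (\<lambda>u v. - r_rtri (T u) v)"
  define ne where "ne = (\<lambda>u v. l_ltri (T u) v)"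
  define sw where "sw = (\<lambda>u v. - r_ltri (T u) v)"
  note prod_defs = se_def nw_def ne_def sw_def
  interpret quadri: L_quadri_algebra scaleV UNIV se ne nw sw
    unfolding prod_defs by (rule L_quadri_algebra_of_O_operator)
  \<comment> \<open>The minus signs in \<open>nw\<close> and \<open>sw\<close> cancel those in the
    horizontal products, leaving exactly the arguments of \<open>T\<close> in the O-operator
    identities.\<close>
  have rtri_eq: "T (horizontal_rtri se nw u v) = rtri (T u) (T v)"
    and ltri_eq: "T (horizontal_ltri ne sw u v) = ltri (T u) (T v)" for u v
    by (simp_all add: horizontal_rtri_def horizontal_ltri_def prod_defs rtri_T ltri_T T.add)
  \<comment> \<open>The codomain stays variable because \<open>T\<close> is needed both as a map
    into all of \<open>A\<close> and as a map onto its range.\<close>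
  have linear_T_on: "linear_on scaleV scaleA UNIV B T" if "range T \<subseteq> B" for B
    using that by (auto simp: linear_on_def T.add T.scale)
  have hom: "L_dendriform_hom scaleV UNIV (horizontal_rtri se nw) (horizontal_ltri ne sw)
      scaleA UNIV rtri ltri T"
    unfolding L_dendriform_hom_def
    using quadri.horizontal_L_dendriform_algebra A linear_T_on rtri_eq ltri_eq by simp
  have subspace: "module.subspace scaleA (range T)"
    using T.subspace_image[OF V.subspace_UNIV] .
  have subalgebra: "L_dendriform_subalgebra scaleA UNIV rtri ltri (range T)"
    unfolding L_dendriform_subalgebra_def
    \<comment> \<open>Read backwards, \<open>rtri_eq\<close> and \<open>ltri_eq\<close> exhibit
      products of elements of the range as values of \<open>T\<close>.\<close>
    using A subspace by (auto simp flip: rtri_eq ltri_eq)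
  \<comment> \<open>\<open>inv T\<close> chooses some preimage; the values for arguments outside the
    range of \<open>T\<close> are irrelevant.\<close>
  define induced where "induced p x y = T (p (inv T x) (inv T y))" for p :: "'v \<Rightarrow> 'v \<Rightarrow> 'v" and x y
  have T_inv: "T (inv T (T u)) = T u" for u
    by (simp add: f_inv_into_f)
  have induced: "induced se (T u) (T v) = T (se u v)" "induced ne (T u) (T v) = T (ne u v)"
    "induced nw (T u) (T v) = T (nw u v)" "induced sw (T u) (T v) = T (sw u v)" for u v
    \<comment> \<open>The chosen preimage of the left factor enters only through its image, so
      \<open>T_inv\<close> suffices there; the right factor needs
      \<open>T_action_cong\<close>.\<close>
    using T_action_cong[OF T_inv[of v], of u]
    by (simp_all add: induced_def prod_defs T_inv T.neg)
  interpret image: L_quadri_algebra scaleA "range T" "induced se" "induced ne" "induced nw" "induced sw"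
    by (rule quadri.L_quadri_algebra_image[OF linear_T]) (simp_all add: induced)
  have restrict: "horizontal_rtri (induced se) (induced nw) (T u) (T v) = rtri (T u) (T v)"
    "horizontal_ltri (induced ne) (induced sw) (T u) (T v) = ltri (T u) (T v)" for u v
    \<comment> \<open>Both sides thereby become images under \<open>T\<close> of the horizontal
      products on \<open>V\<close>.\<close>
    unfolding rtri_eq[symmetric] ltri_eq[symmetric]
    by (simp_all add: horizontal_rtri_def horizontal_ltri_def induced T.diff)
  have quadri_hom: "L_quadri_hom scaleV UNIV se ne nw sw
      scaleA (range T) (induced se) (induced ne) (induced nw) (induced sw) T"
    unfolding L_quadri_hom_def
    using quadri.L_quadri_algebra_axioms image.L_quadri_algebra_axioms linear_T_on induced by simp
  show ?thesis
    unfolding Let_def prod_defs[symmetric]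
    using quadri.L_quadri_algebra_axioms quadri.horizontal_L_dendriform_algebra hom subalgebra
      induced image.L_quadri_algebra_axioms image.horizontal_L_dendriform_algebra restrict quadri_hom
    by (intro conjI exI[of _ "induced se"] exI[of _ "induced ne"] exI[of _ "induced nw"]
        exI[of _ "induced sw"]) auto
qed

end
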